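(* Consider the linear discrete-time stochastic system $x_{k+1}=Fx_k+w_k$, $y_k=Hx_k+n_k$ with $F\in\mathbb{R}^{n_x\times n_x}$, $H\in\mathbb{R}^{n_y\times n_x}$, process noise covariance $Q\succeq0$ and measurement noise covariance $R=R_s+R_p$, where $R_s\succeq 0$ in $\mathbb{R}^{n_y\times n_y}$ is known and $R_p\succeq 0$ in $\mathbb{R}^{n_y\times n_y}$ is a design variable. Let the prior (predicted) error covariance $\Sigma_k^-\succeq 0$ of the Kalman filter at time $k$ be known, and let $\Sigma_{k+1}^-=\Sigma_{k+1}^-(R_p)$ be the predicted error covariance at time $k+1$. Let $\Sigma^d_{k+1}\in\mathbb{R}^{n_x\times n_x}$ be a given (symmetric) positive definite matrix, the desired predicted error variance at time $k+1$, let $W\in\mathbb{R}^{n_y\times n_y}$ be a given weight matrix, and set $$L_1:=F\Sigma_k^-H^T,\qquad L_2:=H\Sigma_k^-H^T+R_s,\qquad M_{11}:=-\Sigma^d_{k+1}+F\Sigma_k^-F^T+Q.$$ Then the optimal measurement noise $R_p$ satisfying $\Sigma_{k+1}^-\succeq\Sigma^d_{k+1}$ (that is, the $R_p\succeq0$ minimizing $\mathrm{tr}(WR_pW^T)$ among all $R_p\succeq 0$ for which $\Sigma_{k+1}^-(R_p)\succeq\Sigma^d_{k+1}$) is given by the optimization problem $$\min_{R_p}\ \mathrm{tr}\left(WR_pW^T\right)\quad\text{subject to}\quad R_p\succeq 0,\quad \begin{bmatrix} M_{11} & L_1\\ L_1^T & L_2+R_p\end{bmatrix}\succeq 0,$$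 over symmetric $R_p\in\mathbb{R}^{n_y\times n_y}$; i.e. $R_p$ is such an optimal measurement noise if and only if it is a minimizer of this optimization problem.
   Context: All matrices are real; for symmetric matrices, $A\succeq B$ means that $A-B$ is positive semidefinite; $\mathrm{tr}$ is the trace. The noises $w_k$ and $n_k$ are zero-mean Gaussian with $\mathbb{E}[w_kw_l^T]=Q\delta_{kl}$ and $\mathbb{E}[n_kn_l^T]=R\delta_{kl}$; $w_k$, $n_k$ and the initial state $x_0$ are independent. The measurement noise covariance is $R=R_s+R_p$, with $R_s$ the known inherent sensor/detection noise covariance and $R_p$ the covariance of the artificially added noise. The predicted error covariance of the Kalman filter at time $k+1$ is given by the Riccati recursion $$\Sigma_{k+1}^-=F\Sigma_k^-F^T+Q-F\Sigma_k^-H^T\left(H\Sigma_k^-H^T+R_s+R_p\right)^{-1}H\Sigma_k^-F^T.$$ The matrix $H\Sigma_k^-H^T+R_s+R_p$ inverted here is taken to be invertible for every $R_p\succeq0$ under consideration, so that the recursion is well defined. *)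

theory Defs
  imports "HOL-Analysis.Analysis"
begin

definition pos_semidef :: "real^'n^'n \<Rightarrow> bool" where
  "pos_semidef A \<longleftrightarrow> transpose A = A \<and> (\<forall>x. 0 \<le> x \<bullet> (A *v x))"

definition pos_def :: "real^'n^'n \<Rightarrow> bool" where
  "pos_def A \<longleftrightarrow> transpose A = A \<and> (\<forall>x. x \<noteq> 0 \<longrightarrow> 0 < x \<bullet> (A *v x))"

definition loewner_ge :: "real^'n^'n \<Rightarrow> real^'n^'n \<Rightarrow> bool" (infix "\<succeq>" 50) where
  "A \<succeq> B \<longleftrightarrow> pos_semidef (A - B)"

definition block_matrix ::
  "real^'m^'m \<Rightarrow> real^'n^'m \<Rightarrow> real^'m^'n \<Rightarrow> real^'n^'n \<Rightarrow> real^('m + 'n)^('m + 'n)" where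
  "block_matrix A B C D =
    (\<chi> i j. case i of
        Inl a \<Rightarrow> (case j of Inl b \<Rightarrow> A $ a $ b | Inr b \<Rightarrow> B $ a $ b)
      | Inr a \<Rightarrow> (case j of Inl b \<Rightarrow> C $ a $ b | Inr b \<Rightarrow> D $ a $ b))"

text \<open>
  One step of the Riccati recursion for the predicted error covariance of the Kalman filter of
  \<open>x\<^sub>k\<^sub>+\<^sub>1 = F x\<^sub>k + w\<^sub>k\<close>, \<open>y\<^sub>k = H x\<^sub>k + n\<^sub>k\<close> with noise covariances \<open>Q\<close> and \<open>R\<close>.
  It is meaningful only if \<open>H \<Sigma> H\<^sup>T + R\<close> is invertible; \<open>matrix_inv\<close> is unspecified otherwise.
\<close>

definition predicted_cov ::
  "real^'nx^'nx \<Rightarrow> real^'nx^'ny \<Rightarrow> real^'nx^'nx \<Rightarrow> real^'ny^'ny \<Rightarrow> real^'nx^'nx \<Rightarrow> real^'nx^'nx" where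
  "predicted_cov F H Q R \<Sigma> =
    F ** \<Sigma> ** transpose F + Q
    - F ** \<Sigma> ** transpose H ** matrix_inv (H ** \<Sigma> ** transpose H + R) ** H ** \<Sigma> ** transpose F"

end

theory Submission
  imports Defs
begin

text \<open>
  For symmetric \<open>D\<close> with inverse \<open>E\<close>, completing the square in the second variable gives
  \<open>x\<^sup>T A x + 2 x\<^sup>T B y + y\<^sup>T D y = x\<^sup>T (A - B E B\<^sup>T) x + (y + E B\<^sup>T x)\<^sup>T D (y + E B\<^sup>T x)\<close>.
  Hence, for positive definite \<open>D\<close>, the block matrix is positive semidefinite iff its Schur
  complement is. With \<open>D = L\<^sub>2 + R\<^sub>p\<close> the Schur complement is \<open>\<Sigma>\<^sub>k\<^sub>+\<^sub>1\<^sup>- - \<Sigma>\<^sup>d\<close>, so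
  the two optimization problems have the same feasible set and the same objective.
\<close>

lemma sum_UNIV_Plus:
  "(\<Sum>i\<in>(UNIV :: ('a::finite + 'b::finite) set). f i) = (\<Sum>a\<in>UNIV. f (Inl a)) + (\<Sum>b\<in>UNIV. f (Inr b))"
  by (simp add: UNIV_Plus_UNIV[symmetric] sum.Plus del: UNIV_Plus_UNIV)

text \<open>The index type is a disjoint sum, so each sum over it splits along \<open>Inl\<close>
  and \<open>Inr\<close>, and the double sum of the form into four.\<close>

lemma block_matrix_quadratic_form:
  fixes v :: "real^('m::finite + 'n::finite)"
  defines "x \<equiv> \<chi> i. v $ Inl i" and "y \<equiv> \<chi> i. v $ Inr i"
  shows "v \<bullet> (block_matrix A B C D *v v)
    = x \<bullet> (A *v x) + x \<bullet> (B *v y) + y \<bullet> (C *v x) + y \<bullet> (D *v y)"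
  by (simp add: x_def y_def inner_vec_def matrix_vector_mult_def block_matrix_def sum_UNIV_Plus
      distrib_left sum.distrib)

lemma transpose_block_matrix:
  "transpose (block_matrix A B C D)
    = block_matrix (transpose A) (transpose C) (transpose B) (transpose D)"
  by (simp add: vec_eq_iff transpose_def block_matrix_def split: sum.split)

text \<open>Used to read off symmetry of a block matrix from its blocks.\<close>

lemma block_matrix_eq_iff:
  "block_matrix A B C D = block_matrix A' B' C' D' \<longleftrightarrow> A = A' \<and> B = B' \<and> C = C' \<and> D = D'"
proof
  assume eq: "block_matrix A B C D = block_matrix A' B' C' D'"
  have "block_matrix A B C D $ i $ j = block_matrix A' B' C' D' $ i $ j" for i j
    using eq by simp
  from this[of "Inl _" "Inl _"] this[of "Inl _" "Inr _"] this[of "Inr _" "Inl _"]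
    this[of "Inr _" "Inr _"]
  show "A = A' \<and> B = B' \<and> C = C' \<and> D = D'"
    by (simp add: block_matrix_def vec_eq_iff)
qed simp

lemma transpose_add: "transpose (A + B) = transpose A + transpose (B :: real^'n^'m)"
  by (simp add: transpose_def vec_eq_iff)

lemma transpose_diff: "transpose (A - B) = transpose A - transpose (B :: real^'n^'m)"
  by (simp add: transpose_def vec_eq_iff)

lemma pos_semidef_add: "pos_semidef A \<Longrightarrow> pos_semidef B \<Longrightarrow> pos_semidef (A + B)"
  by (simp add: pos_semidef_def transpose_add matrix_vector_mult_add_rdistrib inner_add_right)

lemma inner_matrix_vector_mult_transpose:
  "x \<bullet> ((A :: real^'n^'m) *v y) = (transpose A *v x) \<bullet> y"
  by (metis dot_lmul_matrix transpose_matrix_vector)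

text \<open>The form of the product at \<open>x\<close> is the form of \<open>S\<close> at
  \<open>transpose H *v x\<close>.\<close>

lemma pos_semidef_congruence:
  assumes "pos_semidef S"
  shows "pos_semidef (H ** S ** transpose H)"
proof -
  have "x \<bullet> (H ** S ** transpose H *v x) = (transpose H *v x) \<bullet> (S *v (transpose H *v x))" for x
    by (simp add: matrix_vector_mul_assoc[symmetric] inner_matrix_vector_mult_transpose)
  then show ?thesis
    using assms by (simp add: pos_semidef_def matrix_transpose_mul matrix_mul_assoc)
qed

lemma matrix_inv_right:
  fixes D :: "real^'n^'m"
  assumes "invertible D"
  shows "D ** matrix_inv D = mat 1"
  using someI_ex[OF assms[unfolded invertible_def]] by (simp add: matrix_inv_def)

text \<open>Transposing \<open>D ** matrix_inv D = mat 1\<close> makes the transposed inverse a left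
  inverse of \<open>D\<close>; a left and a right inverse coincide.\<close>

lemma transpose_matrix_inv_symmetric:
  fixes D :: "real^'n^'n"
  assumes "invertible D" and "transpose D = D"
  shows "transpose (matrix_inv D) = matrix_inv D"
proof -
  have inv: "D ** matrix_inv D = mat 1"
    using assms(1) by (rule matrix_inv_right)
  then have "transpose (matrix_inv D) ** D = mat 1"
    by (metis assms(2) matrix_transpose_mul transpose_mat)
  then have "transpose (matrix_inv D) ** D ** matrix_inv D = matrix_inv D"
    by simp
  then show ?thesis
    by (simp add: matrix_mul_assoc[symmetric] inv)
qed

text \<open>Semidefinite and invertible together amount to positive definite; the hypotheses are
  split this way because they arise separately for \<open>L2 + R\<close>.\<close>

lemma pos_semidef_block_matrix_iff_schur_complement:
  fixes A :: "real^'m^'m" and B :: "real^'n^'m" and D :: "real^'n^'n"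
  assumes D: "pos_semidef D" and inv: "invertible D"
  shows "pos_semidef (block_matrix A B (transpose B) D)
    \<longleftrightarrow> pos_semidef (A - B ** matrix_inv D ** transpose B)"
proof -
  define E where "E = matrix_inv D"
  have Dt: "transpose D = D"
    using D by (simp add: pos_semidef_def)
  have Et: "transpose E = E"
    unfolding E_def by (rule transpose_matrix_inv_symmetric[OF inv Dt])
  have DE: "D *v (E *v u) = u" for u
    by (simp add: E_def matrix_vector_mul_assoc matrix_inv_right[OF inv])
  have square: "x \<bullet> (A *v x) + x \<bullet> (B *v y) + y \<bullet> (transpose B *v x) + y \<bullet> (D *v y)
      = x \<bullet> ((A - B ** E ** transpose B) *v x)
        + (y + E *v (transpose B *v x)) \<bullet> (D *v (y + E *v (transpose B *v x)))" for x y
  proof -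
    define u where "u = transpose B *v x"
    have "x \<bullet> (B *v y) = y \<bullet> u"
      by (simp add: u_def inner_matrix_vector_mult_transpose inner_commute)
    moreover have "x \<bullet> ((B ** E ** transpose B) *v x) = u \<bullet> (E *v u)"
      by (simp add: u_def matrix_vector_mul_assoc[symmetric] inner_matrix_vector_mult_transpose)
    \<comment> \<open>Moving the symmetric \<open>D\<close> to the left cancels \<open>E\<close>;
      this gives one of the two equal cross terms.\<close>
    moreover have "(E *v u) \<bullet> (D *v y) = y \<bullet> u"
      using inner_matrix_vector_mult_transpose[of "E *v u" D y] by (simp add: Dt DE inner_commute)
    ultimately show ?thesis
      unfolding u_def[symmetric]
      by (simp add: matrix_vector_mult_diff_rdistrib matrix_vector_right_distrib inner_diff_right
          inner_add_left inner_add_right DE inner_commute)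
  qed
  \<comment> \<open>\<open>pos_semidef\<close> includes symmetry, which is not assumed of
    \<open>A\<close>. Both sides here reduce to \<open>transpose A = A\<close>, since
    \<open>D\<close> and \<open>E\<close> are symmetric.\<close>
  have sym: "transpose (block_matrix A B (transpose B) D) = block_matrix A B (transpose B) D
      \<longleftrightarrow> transpose (A - B ** E ** transpose B) = A - B ** E ** transpose B"
    by (simp add: transpose_block_matrix block_matrix_eq_iff Dt Et transpose_diff
        matrix_transpose_mul matrix_mul_assoc)
  have "(\<forall>v. 0 \<le> v \<bullet> (block_matrix A B (transpose B) D *v v))
      \<longleftrightarrow> (\<forall>x. 0 \<le> x \<bullet> ((A - B ** E ** transpose B) *v x))"
  proof (intro iffI allI)
    fix x
    assume nonneg: "\<forall>v. 0 \<le> v \<bullet> (block_matrix A B (transpose B) D *v v)"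
    \<comment> \<open>This choice makes the completed square vanish, leaving only the form of the
      Schur complement.\<close>
    define y where "y = - (E *v (transpose B *v x))"
    define v :: "real^('m + 'n)"
      where "v = (\<chi> i. case i of Inl a \<Rightarrow> x $ a | Inr b \<Rightarrow> y $ b)"
    have "(\<chi> i. v $ Inl i) = x" "(\<chi> i. v $ Inr i) = y"
      by (simp_all add: v_def vec_eq_iff)
    then have "v \<bullet> (block_matrix A B (transpose B) D *v v)
        = x \<bullet> ((A - B ** E ** transpose B) *v x)"
      by (simp only: block_matrix_quadratic_form square) (simp add: y_def)
    with nonneg show "0 \<le> x \<bullet> ((A - B ** E ** transpose B) *v x)"
      by metis
  next
    fix v
    assume "\<forall>x. 0 \<le> x \<bullet> ((A - B ** E ** transpose B) *v x)"
    moreover have "0 \<le> z \<bullet> (D *v z)" for z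
      using D by (simp add: pos_semidef_def)
    ultimately show "0 \<le> v \<bullet> (block_matrix A B (transpose B) D *v v)"
      by (simp only: block_matrix_quadratic_form square add_nonneg_nonneg)
  qed
  with sym show ?thesis
    unfolding pos_semidef_def E_def by simp
qed

theorem theorem2:
  fixes F Q \<Sigma> \<Sigma>d :: "real^'nx^'nx"
    and H :: "real^'nx^'ny"
    and Rs W :: "real^'ny^'ny"
    and Rp :: "real^'ny^'ny"
  defines "L1 \<equiv> F ** \<Sigma> ** transpose H"
    and "L2 \<equiv> H ** \<Sigma> ** transpose H + Rs"
    and "M11 \<equiv> - \<Sigma>d + F ** \<Sigma> ** transpose F + Q"
  assumes "Q \<succeq> 0" and "Rs \<succeq> 0" and "\<Sigma> \<succeq> 0" and "pos_def \<Sigma>d"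
    and "\<And>R :: real^'ny^'ny. R \<succeq> 0 \<Longrightarrow> invertible (H ** \<Sigma> ** transpose H + Rs + R)"
  shows "is_arg_min (\<lambda>R. trace (W ** R ** transpose W))
           (\<lambda>R. R \<succeq> 0 \<and> predicted_cov F H Q (Rs + R) \<Sigma> \<succeq> \<Sigma>d) Rp
     \<longleftrightarrow> is_arg_min (\<lambda>R. trace (W ** R ** transpose W))
           (\<lambda>R. R \<succeq> 0 \<and> block_matrix M11 L1 (transpose L1) (L2 + R) \<succeq> 0) Rp"
proof -
  have St: "transpose \<Sigma> = \<Sigma>"
    using \<open>\<Sigma> \<succeq> 0\<close> by (simp add: loewner_ge_def pos_semidef_def)
  \<comment> \<open>Symmetry of \<open>\<Sigma>\<close> identifies the right-hand factor of the
    Riccati correction term with \<open>transpose L1\<close>.\<close>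
  have L1t: "transpose L1 = H ** \<Sigma> ** transpose F"
    by (simp add: L1_def matrix_transpose_mul St matrix_mul_assoc)
  \<comment> \<open>The restriction to \<open>R \<succeq> 0\<close> makes \<open>L2 + R\<close>
    semidefinite and invertible; it costs nothing, as both feasible sets contain this
    constraint.\<close>
  have "predicted_cov F H Q (Rs + R) \<Sigma> \<succeq> \<Sigma>d
      \<longleftrightarrow> block_matrix M11 L1 (transpose L1) (L2 + R) \<succeq> 0" if R: "R \<succeq> 0" for R
  proof -
    have "pos_semidef (L2 + R)"
      using \<open>\<Sigma> \<succeq> 0\<close> \<open>Rs \<succeq> 0\<close> R
      by (simp add: L2_def loewner_ge_def pos_semidef_add pos_semidef_congruence)
    moreover have "invertible (L2 + R)"
      using assms(8)[OF R] by (simp add: L2_def)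
    ultimately have "block_matrix M11 L1 (transpose L1) (L2 + R) \<succeq> 0
        \<longleftrightarrow> pos_semidef (M11 - L1 ** matrix_inv (L2 + R) ** transpose L1)"
      by (simp add: loewner_ge_def pos_semidef_block_matrix_iff_schur_complement)
    moreover have "predicted_cov F H Q (Rs + R) \<Sigma> - \<Sigma>d
        = M11 - L1 ** matrix_inv (L2 + R) ** transpose L1"
      unfolding L1t
      by (simp add: predicted_cov_def M11_def L1_def L2_def matrix_mul_assoc add.assoc)
    ultimately show ?thesis
      by (simp add: loewner_ge_def)
  qed
  then have "(\<lambda>R. R \<succeq> 0 \<and> predicted_cov F H Q (Rs + R) \<Sigma> \<succeq> \<Sigma>d)
      = (\<lambda>R. R \<succeq> 0 \<and> block_matrix M11 L1 (transpose L1) (L2 + R) \<succeq> 0)"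
    by blast
  then show ?thesis
    by simp
qed

end
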